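(* Let $T\ge1$. Let $\mathcal{A}$ be a one-dimensional online linear optimization algorithm that takes hints, and suppose $\mathcal{A}$ guarantees regret $R_T^{\mathcal{A}}(\mathring{w},h_T)$ given gradients $\tilde g_1,\dots,\tilde g_T$ and hints $h_1\le\dots\le h_T$ such that $|\tilde g_t|\le h_t$ for all $t$; that is, its outputs $w_1,\dots,w_T\in\mathbb{R}$ then satisfy $\sum_{t=1}^T\tilde g_t(w_t-\mathring{w})\le R_T^{\mathcal{A}}(\mathring{w},h_T)$ for all $\mathring{w}\in\mathbb{R}$ (the bound $R_T^{\mathcal{A}}$ may also depend on the gradients $\tilde g_1,\dots,\tilde g_T$ given to $\mathcal{A}$). Let $k,p,\mathfrak{g}>0$. Then for every sequence $g_1,\dots,g_T\in\mathbb{R}$, the points $\tilde w_1,\dots,\tilde w_T$ played by the algorithm LEASHED (defined in the context) with base algorithm $\mathcal{A}$ and parameters $k,p,\mathfrak{g}$ satisfy, for every $\mathring{w}\in\mathbb{R}$, $$\sum_{t=1}^T g_t(\tilde w_t-\mathring{w})\le 2R_T^{\mathcal{A}}(\mathring{w},\max(\mathfrak{g},G))+Gk\left[\max_{t\le T}\left(\sum_{i=1}^t\frac{|g_i|}{G_t}\right)^p\right]+2G|\mathring{w}|+\min_{q\in[0,1]}G\left[\frac{|\mathring{w}|^{1+\frac{1-q}{p}}}{k^{\frac{1-q}{p}}}\left(\sum_{t=1}^T\frac{|g_t|}{G}\right)^q\right],$$ where $G_t=\max_{i\le t}|g_i|$ and $G=\max_{t\le T}|g_t|$.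
   Context: A one-dimensional online linear optimization algorithm that takes hints operates as follows: in round $t$ it first receives a hint $h_t\ge h_{t-1}$, then outputs $w_t\in\mathbb{R}$, then receives a gradient $\tilde g_t\in\mathbb{R}$ with $|\tilde g_t|\le h_t$. In the conclusion, $R_T^{\mathcal{A}}$ refers to the run of $\mathcal{A}$ inside LEASHED, i.e. on the gradients $\tilde g_t$ defined in step (v) below. Algorithm LEASHED with base algorithm $\mathcal{A}$ and parameters $k,p,\mathfrak{g}>0$: initialize $h_1=\mathfrak{g}$, $G_0=0$, $B_1=0$, and send the initial hint $h_1$ to $\mathcal{A}$. For $t=1,\dots,T$: (i) get $w_t$ from $\mathcal{A}$; let $\tilde w_t$ be the projection of $w_t$ onto $[-B_t,B_t]$ (i.e. $\tilde w_t=B_tw_t/|w_t|$ if $|w_t|\ge B_t$ and $w_t\neq0$; $\tilde w_t=w_t$ otherwise); (ii) play $\tilde w_t$ and receive $g_t\in\mathbb{R}$; (iii) set $G_t=\max(G_{t-1},|g_t|)$, $h_{t+1}=\max(h_t,|g_t|)$, and $B_{t+1}=k\left(\sum_{i=1}^t|g_i|/G_t\right)^p$; (iv) if $|g_t|\ge h_t$ set $g_t^{\mathrm{trunc}}=h_tg_t/|g_t|$, otherwise set $g_t^{\mathrm{trunc}}=g_t$; (v) set $\tilde\ell_t(w)=\frac12\left(g_t^{\mathrm{trunc}}w+|g_t^{\mathrm{trunc}}|\max(0,|w|-B_t)\right)$, compute a subgradient $\tilde g_t\in\partial\tilde\ell_t(w_t)$, and send $\tilde g_t$ and the next hint $h_{t+1}$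 to $\mathcal{A}$. Convention: $0/0=0$ in ratios such as $\sum_{i\le t}|g_i|/G_t$ when $G_t=0$.
   Formalization: The formal theorem additionally assumes that the regret bound R_T^A is nondecreasing in its hint argument; without this the claim can fail, since the last hint used h_T may be smaller than max(𝔤,G). *)

theory Defs
  imports Complex_Main
begin

section \<open>One-dimensional learners with hints\<close>

text \<open>
  Sequences are functions on \<open>nat\<close> whose entries \<open>1, \<dots>, T\<close> matter. A learner maps the hints
  \<open>[h 1, \<dots>, h t]\<close> and the gradients \<open>[gt 1, \<dots>, gt (t - 1)]\<close> to its output of round \<open>t\<close>.
\<close>

type_synonym hint_learner = "real list \<Rightarrow> real list \<Rightarrow> real"

definition learner_output ::
    "hint_learner \<Rightarrow> (nat \<Rightarrow> real) \<Rightarrow> (nat \<Rightarrow> real) \<Rightarrow> nat \<Rightarrow> real" where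
  "learner_output A h gt t = A (map h [1..<Suc t]) (map gt [1..<t])"

text \<open>
  A regret bound \<open>R u H gs\<close> depends on the comparator \<open>u\<close>, the last hint \<open>H\<close> and the list \<open>gs\<close> of
  gradients given to the learner.
\<close>

definition guarantees_regret ::
    "hint_learner \<Rightarrow> nat \<Rightarrow> (real \<Rightarrow> real \<Rightarrow> real list \<Rightarrow> real) \<Rightarrow> bool" where
  "guarantees_regret A T R \<longleftrightarrow>
     (\<forall>h gt. (\<forall>t\<in>{1..<T}. h t \<le> h (Suc t)) \<longrightarrow> (\<forall>t\<in>{1..T}. \<bar>gt t\<bar> \<le> h t) \<longrightarrow>
       (\<forall>u. (\<Sum>t=1..T. gt t * (learner_output A h gt t - u)) \<le> R u (h T) (map gt [1..<Suc T])))"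

text \<open>
  The last hint used by the learner inside LEASHED is \<open>max \<eta> \<bar>g 1\<bar> \<dots> \<bar>g (T - 1)\<bar>\<close>, which can be
  smaller than the argument \<open>max \<eta> G\<close> of its regret bound in the regret bound of LEASHED. Passing
  from the one to the other needs a bound that does not decrease when the hint grows.
\<close>

definition mono_in_hint :: "nat \<Rightarrow> (real \<Rightarrow> real \<Rightarrow> real list \<Rightarrow> real) \<Rightarrow> bool" where
  "mono_in_hint T R \<longleftrightarrow>
     (\<forall>u H H' gs. 0 < H \<longrightarrow> H \<le> H' \<longrightarrow> length gs = T \<longrightarrow> (\<forall>x\<in>set gs. \<bar>x\<bar> \<le> H) \<longrightarrow>
       R u H gs \<le> R u H' gs)"


section \<open>The algorithm LEASHED\<close>

definition subdifferential :: "(real \<Rightarrow> real) \<Rightarrow> real \<Rightarrow> real set" where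
  "subdifferential f x = {s. \<forall>y. f x + s * (y - x) \<le> f y}"

primrec leashed_G :: "(nat \<Rightarrow> real) \<Rightarrow> nat \<Rightarrow> real" where
  "leashed_G g 0 = 0"
| "leashed_G g (Suc t) = max (leashed_G g t) \<bar>g (Suc t)\<bar>"

text \<open>In the next two functions index \<open>0\<close> is a dummy; the initial values are those at index \<open>1\<close>.\<close>

primrec leashed_h :: "real \<Rightarrow> (nat \<Rightarrow> real) \<Rightarrow> nat \<Rightarrow> real" where
  "leashed_h \<eta> g 0 = \<eta>"
| "leashed_h \<eta> g (Suc t) = (if t = 0 then \<eta> else max (leashed_h \<eta> g t) \<bar>g t\<bar>)"

primrec leashed_B :: "real \<Rightarrow> real \<Rightarrow> (nat \<Rightarrow> real) \<Rightarrow> nat \<Rightarrow> real" where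
  "leashed_B k p g 0 = 0"
| "leashed_B k p g (Suc t) =
     (if t = 0 then 0 else k * (\<Sum>i=1..t. \<bar>g i\<bar> / leashed_G g t) powr p)"

definition leashed_proj :: "real \<Rightarrow> real \<Rightarrow> real" where
  "leashed_proj B w = (if \<bar>w\<bar> \<ge> B \<and> w \<noteq> 0 then B * w / \<bar>w\<bar> else w)"

definition leashed_trunc :: "real \<Rightarrow> real \<Rightarrow> real" where
  "leashed_trunc h x = (if \<bar>x\<bar> \<ge> h then h * x / \<bar>x\<bar> else x)"

definition leashed_loss :: "real \<Rightarrow> real \<Rightarrow> real \<Rightarrow> real" where
  "leashed_loss x B w = (x * w + \<bar>x\<bar> * max 0 (\<bar>w\<bar> - B)) / 2"

text \<open>
  \<open>leashed_run A k p \<eta> T g w wt gt\<close>: on the gradients \<open>g\<close>, \<open>T\<close> rounds of LEASHED can produce the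
  base outputs \<open>w\<close>, the played points \<open>wt\<close> and the surrogate gradients \<open>gt\<close>. This is a relation
  because the choice of the subgradient \<open>gt t\<close> is free.
\<close>

definition leashed_run ::
    "hint_learner \<Rightarrow> real \<Rightarrow> real \<Rightarrow> real \<Rightarrow> nat \<Rightarrow> (nat \<Rightarrow> real) \<Rightarrow>
     (nat \<Rightarrow> real) \<Rightarrow> (nat \<Rightarrow> real) \<Rightarrow> (nat \<Rightarrow> real) \<Rightarrow> bool" where
  "leashed_run A k p \<eta> T g w wt gt \<longleftrightarrow>
     (\<forall>t\<in>{1..T}.
        w t = learner_output A (leashed_h \<eta> g) gt t \<and>
        wt t = leashed_proj (leashed_B k p g t) (w t) \<and>
        gt t \<in> subdifferential
          (leashed_loss (leashed_trunc (leashed_h \<eta> g t) (g t)) (leashed_B k p g t)) (w t))"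


section \<open>Quantities in the regret bound\<close>

definition max_grad :: "(nat \<Rightarrow> real) \<Rightarrow> nat \<Rightarrow> real" where
  "max_grad g t = (MAX i\<in>{1..t}. \<bar>g i\<bar>)"

text \<open>
  The infimum over \<open>q \<in> {0..1}\<close> is a minimum. If the sum vanishes at \<open>q = 0\<close>, then so does the
  factor \<open>max_grad g T\<close>, and the value of \<open>0 powr 0\<close> is irrelevant.
\<close>

lemma tradeoff_attains_min:
  fixes k p u :: real
  defines "F \<equiv> \<lambda>q T g. max_grad g T *
    (\<bar>u\<bar> powr (1 + (1 - q) / p) / k powr ((1 - q) / p) *
      (\<Sum>t=1..T. \<bar>g t\<bar> / max_grad g T) powr q)"
  assumes "p > 0" "k > 0"
  shows "\<exists>q\<in>{0..1}. F q T g = (INF q\<in>{0..1}. F q T g)"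
proof -
  let ?S = "\<Sum>t=1..T. \<bar>g t\<bar> / max_grad g T"
  have "\<exists>q\<in>{0..1}. \<forall>r\<in>{0..1}. F q T g \<le> F r T g"
  proof (cases "u = 0 \<or> ?S = 0")
    case True
    then have "F r T g = 0" for r
      unfolding F_def by auto
    then show ?thesis
      by (auto intro!: bexI[of _ 0])
  next
    case False
    then have "continuous_on {0..1} (\<lambda>q. F q T g)"
      unfolding F_def using assms(2,3) by (intro continuous_intros) auto
    then show ?thesis
      by (intro continuous_attains_inf) auto
  qed
  then obtain q where q: "q \<in> {0..1}" "\<And>r. r \<in> {0..1} \<Longrightarrow> F q T g \<le> F r T g"
    by blast
  then have "(INF q\<in>{0..1}. F q T g) = F q T g"
    by (intro cInf_eq_minimum) auto
  then show ?thesis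
    using q(1) by auto
qed

end

theory Submission
  imports Defs
begin

text \<open>
  Write \<open>c t\<close> for the truncated gradient. As \<open>\<bar>g t - c t\<bar> = h (t + 1) - h t\<close>, replacing \<open>g\<close> by \<open>c\<close>
  costs at most \<open>(\<Sum>t. h (t + 1) - h t) * (max B + \<bar>u\<bar>) \<le> G * (max B + \<bar>u\<bar>)\<close>. In each round
  \<open>c t * (wt t - u)\<close> is at most twice the regret of the surrogate loss plus
  \<open>\<bar>c t\<bar> * max 0 (\<bar>u\<bar> - B t)\<close>. If \<open>s\<close> is the last round with \<open>B s < \<bar>u\<bar>\<close>, the latter terms sum to at
  most \<open>\<bar>u\<bar> * (G + (\<Sum>i<s. \<bar>g i\<bar>))\<close>, and \<open>B s < \<bar>u\<bar>\<close> bounds this last sum by \<open>G * (\<bar>u\<bar> / k) powr (1 / p)\<close>.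
  Interpolating with the trivial bound \<open>\<Sum>t. \<bar>g t\<bar>\<close> gives the term with the parameter \<open>q\<close>.
\<close>

section \<open>Projection, truncation and the surrogate loss in a single round\<close>

lemma leashed_proj_dist:
  assumes "B \<ge> 0"
  shows "\<bar>leashed_proj B w - w\<bar> = max 0 (\<bar>w\<bar> - B)"
proof (cases "\<bar>w\<bar> \<ge> B \<and> w \<noteq> 0")
  case True
  then show ?thesis
    by (cases "w > 0") (auto simp: leashed_proj_def)
qed (use assms in \<open>auto simp: leashed_proj_def\<close>)

lemma leashed_proj_abs_le:
  assumes "B \<ge> 0"
  shows "\<bar>leashed_proj B w\<bar> \<le> B"
  using assms by (auto simp: leashed_proj_def abs_mult)

lemma leashed_trunc_abs:
  assumes "h > 0"
  shows "\<bar>leashed_trunc h x\<bar> = min h \<bar>x\<bar>"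
  using assms by (auto simp: leashed_trunc_def abs_mult)

text \<open>With \<open>h\<close> the current hint, the right-hand side is exactly the increase to
  the next hint, so truncation errors telescope over the rounds.\<close>

lemma leashed_trunc_dist:
  assumes "h > 0"
  shows "\<bar>x - leashed_trunc h x\<bar> = max h \<bar>x\<bar> - h"
  using assms by (cases "x > 0") (auto simp: leashed_trunc_def)

text \<open>The growth bound is only asked for at the base point \<open>x\<close>; testing the
  subgradient at \<open>x + 1\<close> and \<open>x - 1\<close> already bounds \<open>s\<close> from
  both sides.\<close>

lemma subdifferential_lipschitz:
  assumes "s \<in> subdifferential f x" and "\<And>y. f y - f x \<le> L * \<bar>y - x\<bar>"
  shows "\<bar>s\<bar> \<le> L"
proof -
  have "s * (y - x) \<le> L * \<bar>y - x\<bar>" for y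
    using assms(1) assms(2)[of y] unfolding subdifferential_def
    by (smt (verit) mem_Collect_eq)
  from this[of "x + 1"] this[of "x - 1"] show ?thesis
    by auto
qed

text \<open>The linear term and the penalty each have Lipschitz constant
  \<open>\<bar>c\<bar>\<close>, and the factor 1/2 in the loss halves their total. This keeps the
  surrogate gradients within the hints.\<close>

lemma leashed_loss_lipschitz: "leashed_loss c B y - leashed_loss c B x \<le> \<bar>c\<bar> * \<bar>y - x\<bar>"
proof -
  have "c * y - c * x \<le> \<bar>c\<bar> * \<bar>y - x\<bar>"
    by (metis abs_ge_self abs_mult right_diff_distrib)
  moreover have "\<bar>c\<bar> * max 0 (\<bar>y\<bar> - B) - \<bar>c\<bar> * max 0 (\<bar>x\<bar> - B) \<le> \<bar>c\<bar> * \<bar>y - x\<bar>"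
    unfolding right_diff_distrib[symmetric] by (intro mult_left_mono) auto
  ultimately show ?thesis
    by (auto simp: leashed_loss_def field_simps)
qed

text \<open>The penalty pays for the projection: moving \<open>w\<close> to its projection changes
  the linear term by at most \<open>\<bar>c\<bar>\<close> times the distance
  \<open>max 0 (\<bar>w\<bar> - B)\<close>.\<close>

lemma leashed_proj_le_loss:
  assumes "B \<ge> 0"
  shows "c * leashed_proj B w \<le> 2 * leashed_loss c B w"
proof -
  have "c * (leashed_proj B w - w) \<le> \<bar>c\<bar> * max 0 (\<bar>w\<bar> - B)"
    using leashed_proj_dist[OF assms] by (metis abs_ge_self abs_mult)
  then show ?thesis
    by (simp add: leashed_loss_def right_diff_distrib)
qed

text \<open>The subgradient inequality compares the losses at \<open>w\<close> and \<open>u\<close>.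
  Twice the loss at \<open>u\<close> exceeds \<open>c * u\<close> by the penalty of
  \<open>u\<close>, which is the last term.\<close>

lemma leashed_round_regret:
  assumes "B \<ge> 0" "s \<in> subdifferential (leashed_loss c B) w"
  shows "c * (leashed_proj B w - u) \<le> 2 * (s * (w - u)) + \<bar>c\<bar> * max 0 (\<bar>u\<bar> - B)"
proof -
  have "leashed_loss c B w - leashed_loss c B u \<le> s * (w - u)"
    using assms(2) unfolding subdifferential_def by (auto simp: algebra_simps)
  moreover have "c * u = 2 * leashed_loss c B u - \<bar>c\<bar> * max 0 (\<bar>u\<bar> - B)"
    by (simp add: leashed_loss_def field_simps)
  ultimately show ?thesis
    using leashed_proj_le_loss[OF assms(1), of c w] by (simp add: right_diff_distrib)
qed

section \<open>Closed forms and bounds for the running maxima, hints and leash lengths\<close>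

lemma leashed_G_le_iff:
  "leashed_G g t \<le> x \<longleftrightarrow> 0 \<le> x \<and> (\<forall>i\<in>{1..t}. \<bar>g i\<bar> \<le> x)"
  by (induction t) (auto simp: le_Suc_eq)

text \<open>Both sides have the same upper bounds. At \<open>t = 0\<close> the maximum would range
  over the empty set.\<close>

lemma max_grad_eq_leashed_G:
  assumes "t \<ge> 1"
  shows "max_grad g t = leashed_G g t"
proof (rule antisym)
  show "max_grad g t \<le> leashed_G g t"
    unfolding max_grad_def using assms leashed_G_le_iff[of g t "leashed_G g t"]
    by (intro Max.boundedI) auto
  have "\<bar>g i\<bar> \<le> max_grad g t" if "i \<in> {1..t}" for i
    unfolding max_grad_def using that by (intro Max_ge) auto
  moreover from this[of 1] have "0 \<le> max_grad g t"
    using assms by force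
  ultimately show "leashed_G g t \<le> max_grad g t"
    by (simp add: leashed_G_le_iff)
qed

lemma leashed_G_nonneg: "0 \<le> leashed_G g t"
  by (induction t) auto

lemma leashed_G_mono: "s \<le> t \<Longrightarrow> leashed_G g s \<le> leashed_G g t"
  by (rule lift_Suc_mono_le[of "leashed_G g"]) auto

lemma abs_le_leashed_G: "1 \<le> i \<Longrightarrow> i \<le> t \<Longrightarrow> \<bar>g i\<bar> \<le> leashed_G g t"
  using leashed_G_le_iff[of g t "leashed_G g t"] by auto

lemma leashed_h_Suc: "\<eta> > 0 \<Longrightarrow> leashed_h \<eta> g (Suc t) = max \<eta> (leashed_G g t)"
proof (induction t)
  case (Suc t)
  have "leashed_h \<eta> g (Suc (Suc t)) = max (leashed_h \<eta> g (Suc t)) \<bar>g (Suc t)\<bar>"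
    by simp
  then show ?case
    using Suc by (simp only: leashed_G.simps max.assoc)
qed simp

lemma leashed_h_pos: "\<eta> > 0 \<Longrightarrow> 0 < leashed_h \<eta> g t"
  by (cases t) (auto simp del: leashed_h.simps(2) simp: leashed_h_Suc)

lemma leashed_B_nonneg: "k > 0 \<Longrightarrow> 0 \<le> leashed_B k p g t"
  by (cases t) auto

lemma leashed_B_le_Max:
  assumes "k > 0" "t \<in> {1..T}"
  shows "leashed_B k p g t \<le> k * (MAX t\<in>{1..T}. (\<Sum>i=1..t. \<bar>g i\<bar> / max_grad g t) powr p)"
    (is "_ \<le> k * Max (?f ` _)")
proof -
  have le: "?f s \<le> Max (?f ` {1..T})" if "s \<in> {1..T}" for s
    using that by (intro Max_ge) auto
  show ?thesis
  \<comment> \<open>The leash of round \<open>t\<close> is built from the gradients up to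
    \<open>t - 1\<close>, so it matches the entry \<open>t - 1\<close> of the maximum. The first
    leash is 0 and has no such entry, but the maximum is nonnegative.\<close>
  proof (cases "t = 1")
    case True
    have "0 \<le> ?f t"
      by simp
    also note le[OF assms(2)]
    finally show ?thesis
      using True assms(1) by simp
  next
    case False
    then obtain s where s: "t = Suc s" "s \<ge> 1"
      using assms(2) by (cases t) auto
    then show ?thesis
      using le[of s] assms by (simp add: max_grad_eq_leashed_G)
  qed
qed

section \<open>Sums over all rounds: truncation error and penalty of the comparator\<close>

lemma sum_trunc_error_le:
  assumes "\<eta> > 0"
  shows "(\<Sum>t=1..T. \<bar>g t - leashed_trunc (leashed_h \<eta> g t) (g t)\<bar>) \<le> leashed_G g T"
proof -
  have "(\<Sum>t=1..T. \<bar>g t - leashed_trunc (leashed_h \<eta> g t) (g t)\<bar>)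
      = (\<Sum>t=1..T. leashed_h \<eta> g (Suc t) - leashed_h \<eta> g t)"
    by (intro sum.cong) (auto simp: leashed_trunc_dist leashed_h_pos assms)
  also have "\<dots> = leashed_h \<eta> g (Suc T) - leashed_h \<eta> g 1"
    by (subst sum_Suc_diff) auto
  also have "\<dots> \<le> leashed_G g T"
    using assms leashed_G_nonneg[of g T] by (simp add: leashed_h_Suc del: leashed_h.simps)
  finally show ?thesis .
qed

text \<open>The sum divided by \<open>G\<close> has two upper bounds:
  \<open>(\<bar>u\<bar> / k) powr (1 / p)\<close>, from the short leash, and the normalized sum over
  all rounds. The claim is their geometric mean with weights \<open>1 - q\<close> and
  \<open>q\<close>.\<close>

lemma sum_before_le_interpolation:
  fixes g :: "nat \<Rightarrow> real"
  assumes "k > 0" "p > 0" "q \<in> {0..1}" "s < T" and B: "leashed_B k p g (Suc s) < \<bar>u\<bar>"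
  defines "G \<equiv> leashed_G g T"
  shows "(\<Sum>i=1..s. \<bar>g i\<bar>)
    \<le> G * ((\<bar>u\<bar> / k) powr ((1 - q) / p) * (\<Sum>t=1..T. \<bar>g t\<bar> / G) powr q)"
proof -
  define S where "S = (\<Sum>i=1..s. \<bar>g i\<bar>)"
  have G_nonneg: "0 \<le> G"
    unfolding G_def by (rule leashed_G_nonneg)
  have S_nonneg: "0 \<le> S"
    by (auto simp: S_def intro: sum_nonneg)
  show ?thesis
  proof (cases "S = 0")
    case True
    then show ?thesis
      using G_nonneg S_def by simp
  next
    case False
    then have S: "S > 0"
      using S_nonneg by simp
    have s: "s \<noteq> 0"
      using S by (cases s) (auto simp: S_def)
    \<comment> \<open>Makes the quotients below genuine rather than the default
      \<open>x / 0 = 0\<close>.\<close>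
    have Gs: "leashed_G g s > 0"
    proof (rule ccontr)
      assume "\<not> ?thesis"
      then have "\<bar>g i\<bar> \<le> 0" if "i \<in> {1..s}" for i
        using abs_le_leashed_G[of i s g] that by auto
      then have "S \<le> 0"
        unfolding S_def by (intro sum_nonpos)
      with S show False
        by simp
    qed
    have le: "leashed_G g s \<le> G"
      using assms(4) by (auto simp: G_def intro: leashed_G_mono)
    with Gs have G: "G > 0"
      by simp
    have "(S / leashed_G g s) powr p < \<bar>u\<bar> / k"
      using B s assms(1) by (simp add: S_def sum_divide_distrib field_simps)
    then have "((S / leashed_G g s) powr p) powr (1 / p) \<le> (\<bar>u\<bar> / k) powr (1 / p)"
      using assms(2) by (intro powr_mono2) auto
    then have "S / leashed_G g s \<le> (\<bar>u\<bar> / k) powr (1 / p)"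
      using assms(2) S Gs by (simp add: powr_powr)
    \<comment> \<open>The leash is normalized by the maximum up to \<open>s\<close>; passing to the
      final maximum only shrinks the ratio.\<close>
    moreover have "S / G \<le> S / leashed_G g s"
      using le Gs S by (intro divide_left_mono) auto
    ultimately have 1: "S / G \<le> (\<bar>u\<bar> / k) powr (1 / p)"
      by simp
    have "S \<le> (\<Sum>t=1..T. \<bar>g t\<bar>)"
      unfolding S_def using assms(4) by (intro sum_mono2) auto
    then have 2: "S / G \<le> (\<Sum>t=1..T. \<bar>g t\<bar> / G)"
      using G by (simp add: divide_right_mono flip: sum_divide_distrib)
    have "S / G = (S / G) powr (1 - q) * (S / G) powr q"
      using S G by (simp flip: powr_add)
    also have "\<dots> \<le> ((\<bar>u\<bar> / k) powr (1 / p)) powr (1 - q) * (\<Sum>t=1..T. \<bar>g t\<bar> / G) powr q"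
      using 1 2 S G assms(3) by (intro mult_mono powr_mono2) auto
    finally have "S / G \<le> (\<bar>u\<bar> / k) powr ((1 - q) / p) * (\<Sum>t=1..T. \<bar>g t\<bar> / G) powr q"
      by (simp add: powr_powr)
    then show ?thesis
      using G by (simp add: S_def field_simps)
  qed
qed

lemma sum_outside_leash_le:
  fixes g c :: "nat \<Rightarrow> real"
  assumes "k > 0" "p > 0" "q \<in> {0..1}" and c: "\<And>t. t \<in> {1..T} \<Longrightarrow> \<bar>c t\<bar> \<le> \<bar>g t\<bar>"
  defines "G \<equiv> leashed_G g T"
  shows "(\<Sum>t=1..T. \<bar>c t\<bar> * max 0 (\<bar>u\<bar> - leashed_B k p g t))
    \<le> G * \<bar>u\<bar> + G * (\<bar>u\<bar> powr (1 + (1 - q) / p) / k powr ((1 - q) / p) *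
        (\<Sum>t=1..T. \<bar>g t\<bar> / G) powr q)"
proof -
  define N where "N = {t\<in>{1..T}. leashed_B k p g t < \<bar>u\<bar>}"
  let ?r = "\<lambda>t. \<bar>c t\<bar> * max 0 (\<bar>u\<bar> - leashed_B k p g t)"
  have G_nonneg: "0 \<le> G"
    unfolding G_def by (rule leashed_G_nonneg)
  have r0: "?r t = 0" if "t \<in> {1..T} - N" for t
    using that by (auto simp: N_def)
  show ?thesis
  proof (cases "N = {}")
    case True
    then have "(\<Sum>t=1..T. ?r t) = 0"
      using r0 by (intro sum.neutral) blast
    then show ?thesis
      using G_nonneg by simp
  next
    case False
    have fin: "finite N"
      by (simp add: N_def)
    have "Max N \<in> N"
      using False fin by (rule Max_in[rotated])
    moreover then obtain s where s: "Max N = Suc s"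
      by (cases "Max N") (auto simp: N_def)
    ultimately have sT: "s < T" and B: "leashed_B k p g (Suc s) < \<bar>u\<bar>"
      by (auto simp: N_def)
    have u: "\<bar>u\<bar> > 0"
      using B leashed_B_nonneg[OF assms(1), of p g "Suc s"] by linarith
    have sub: "N \<subseteq> {1..Suc s}"
      using Max_ge[OF fin] by (auto simp: s N_def simp flip: s)
    have "(\<Sum>t=1..T. ?r t) = (\<Sum>t\<in>{1..Suc s}. ?r t)"
    proof (intro sum.mono_neutral_right ballI)
      show "?r t = 0" if "t \<in> {1..T} - {1..Suc s}" for t
        using sub that by (intro r0) auto
    qed (use sT in auto)
    also have "\<dots> \<le> (\<Sum>t\<in>{1..Suc s}. \<bar>g t\<bar> * \<bar>u\<bar>)"
      using c sT leashed_B_nonneg[OF assms(1)] by (intro sum_mono mult_mono) auto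
    \<comment> \<open>Round \<open>Suc s\<close> is split off because its leash only controls the
      gradients up to \<open>s\<close>; it contributes the term
      \<open>G * \<bar>u\<bar>\<close>.\<close>
    also have "\<dots> = \<bar>g (Suc s)\<bar> * \<bar>u\<bar> + \<bar>u\<bar> * (\<Sum>t=1..s. \<bar>g t\<bar>)"
      by (simp add: sum_distrib_left mult.commute)
    also have "\<dots> \<le> G * \<bar>u\<bar> + \<bar>u\<bar> *
        (G * ((\<bar>u\<bar> / k) powr ((1 - q) / p) * (\<Sum>t=1..T. \<bar>g t\<bar> / G) powr q))"
      using sum_before_le_interpolation[OF assms(1-3) sT B] abs_le_leashed_G[of "Suc s" T g] sT
      by (intro add_mono mult_right_mono mult_left_mono) (auto simp: G_def)
    also have "\<dots> = G * \<bar>u\<bar> + G * (\<bar>u\<bar> powr (1 + (1 - q) / p) / k powr ((1 - q) / p) *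
        (\<Sum>t=1..T. \<bar>g t\<bar> / G) powr q)"
      using u assms(1) by (simp add: powr_add powr_divide)
    finally show ?thesis .
  qed
qed

section \<open>The regret bound of LEASHED\<close>

theorem theorem3:
  fixes A :: hint_learner
    and R :: "real \<Rightarrow> real \<Rightarrow> real list \<Rightarrow> real"
    and T :: nat
    and k p \<eta> :: real
    and g w wt gt :: "nat \<Rightarrow> real"
    and u :: real
  assumes "T \<ge> 1"
    and "guarantees_regret A T R"
    and "mono_in_hint T R"
    and "k > 0" "p > 0" "\<eta> > 0"
    and "leashed_run A k p \<eta> T g w wt gt"
  shows "(\<Sum>t=1..T. g t * (wt t - u))
    \<le> 2 * R u (max \<eta> (max_grad g T)) (map gt [1..<Suc T])
      + max_grad g T * k * (MAX t\<in>{1..T}. (\<Sum>i=1..t. \<bar>g i\<bar> / max_grad g t) powr p)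
      + 2 * max_grad g T * \<bar>u\<bar>
      + (INF q\<in>{0..1}. max_grad g T *
          (\<bar>u\<bar> powr (1 + (1 - q) / p) / k powr ((1 - q) / p) *
            (\<Sum>t=1..T. \<bar>g t\<bar> / max_grad g T) powr q))"
proof -
  let ?h = "leashed_h \<eta> g" and ?B = "leashed_B k p g"
  define G where "G = max_grad g T"
  define M where "M = (MAX t\<in>{1..T}. (\<Sum>i=1..t. \<bar>g i\<bar> / max_grad g t) powr p)"
  define c where "c = (\<lambda>t. leashed_trunc (?h t) (g t))"
  define Q where "Q = (\<lambda>q. G * (\<bar>u\<bar> powr (1 + (1 - q) / p) / k powr ((1 - q) / p) *
            (\<Sum>t=1..T. \<bar>g t\<bar> / G) powr q))"
  have G_eq: "G = leashed_G g T"
    using assms(1) by (simp add: G_def max_grad_eq_leashed_G)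
  have w: "w t = learner_output A ?h gt t" and wt: "wt t = leashed_proj (?B t) (w t)"
    and gt: "gt t \<in> subdifferential (leashed_loss (c t) (?B t)) (w t)" if "t \<in> {1..T}" for t
    using assms(7) that unfolding leashed_run_def c_def by blast+
  have c: "\<bar>c t\<bar> = min (?h t) \<bar>g t\<bar>" for t
    using assms(6) by (simp add: c_def leashed_trunc_abs leashed_h_pos)
  have B_nonneg: "0 \<le> ?B t" for t
    using assms(4) by (rule leashed_B_nonneg)
  have "(\<Sum>t=1..T. (g t - c t) * (wt t - u)) \<le> (\<Sum>t=1..T. \<bar>g t - c t\<bar> * (k * M + \<bar>u\<bar>))"
  proof (intro sum_mono)
    fix t assume t: "t \<in> {1..T}"
    have "\<bar>wt t\<bar> \<le> ?B t"
      using B_nonneg t by (simp add: wt leashed_proj_abs_le)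
    also have "\<dots> \<le> k * M"
      unfolding M_def using assms(4) t by (rule leashed_B_le_Max)
    finally have "\<bar>g t - c t\<bar> * \<bar>wt t - u\<bar> \<le> \<bar>g t - c t\<bar> * (k * M + \<bar>u\<bar>)"
      by (intro mult_left_mono) auto
    then show "(g t - c t) * (wt t - u) \<le> \<bar>g t - c t\<bar> * (k * M + \<bar>u\<bar>)"
      by (metis abs_ge_self abs_mult order_trans)
  qed
  also have "\<dots> = (\<Sum>t=1..T. \<bar>g t - c t\<bar>) * (k * M + \<bar>u\<bar>)"
    by (simp add: sum_distrib_right)
  also have "\<dots> \<le> G * (k * M + \<bar>u\<bar>)"
  proof (rule mult_right_mono)
    show "(\<Sum>t=1..T. \<bar>g t - c t\<bar>) \<le> G"
      unfolding c_def G_eq using assms(6) by (rule sum_trunc_error_le)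
    \<comment> \<open>Round 1 exists since \<open>T \<ge> 1\<close>, and its leash witnesses
      \<open>0 \<le> k * M\<close>.\<close>
    have "0 \<le> ?B 1"
      by (rule B_nonneg)
    also have "\<dots> \<le> k * M"
      unfolding M_def using assms(1,4) by (intro leashed_B_le_Max) auto
    finally show "0 \<le> k * M + \<bar>u\<bar>"
      by simp
  qed
  finally have error: "(\<Sum>t=1..T. (g t - c t) * (wt t - u)) \<le> G * (k * M + \<bar>u\<bar>)" .

  \<comment> \<open>Truncation enters here: the surrogate gradient is at most
    \<open>\<bar>c t\<bar>\<close>, hence admissible for the base learner.\<close>
  have gt_le: "\<bar>gt t\<bar> \<le> ?h t" if "t \<in> {1..T}" for t
    using subdifferential_lipschitz[OF gt[OF that] leashed_loss_lipschitz] c[of t] by linarith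
  have "(\<Sum>t=1..T. gt t * (w t - u)) = (\<Sum>t=1..T. gt t * (learner_output A ?h gt t - u))"
    by (intro sum.cong) (auto simp: w)
  also have "\<dots> \<le> R u (?h T) (map gt [1..<Suc T])"
    using assms(2) gt_le unfolding guarantees_regret_def by fastforce
  \<comment> \<open>The last hint misses \<open>g T\<close>, so \<open>mono_in_hint\<close> is
    applied; it requires all surrogate gradients to be bounded by the smaller hint
    \<open>?h T\<close>, hence \<open>h_mono\<close>.\<close>
  also have "\<dots> \<le> R u (max \<eta> G) (map gt [1..<Suc T])"
  proof -
    obtain T' where T': "T = Suc T'"
      using assms(1) by (cases T) auto
    have h_mono: "?h s \<le> ?h t" if "1 \<le> s" "s \<le> t" for s t
      using that assms(6) leashed_G_mono[of "s - 1" "t - 1" g] leashed_h_Suc[of \<eta> g "s - 1"]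
        leashed_h_Suc[of \<eta> g "t - 1"] by (simp add: max.coboundedI2)
    have "\<bar>gt t\<bar> \<le> ?h T" if "t \<in> {1..T}" for t
      using gt_le[OF that] h_mono[of t T] that by auto
    then have "\<forall>x\<in>set (map gt [1..<Suc T]). \<bar>x\<bar> \<le> ?h T"
      by (auto simp del: upt_Suc)
    moreover have "?h T \<le> max \<eta> G"
      using assms(6) by (simp add: T' G_eq leashed_h_Suc del: leashed_h.simps)
    moreover have "0 < ?h T"
      using assms(6) by (rule leashed_h_pos)
    moreover have "length (map gt [1..<Suc T]) = T"
      by simp
    ultimately show ?thesis
      using assms(3) unfolding mono_in_hint_def by blast
  qed
  finally have base: "(\<Sum>t=1..T. gt t * (w t - u)) \<le> R u (max \<eta> G) (map gt [1..<Suc T])" .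

  have "(\<Sum>t=1..T. c t * (wt t - u))
      \<le> (\<Sum>t=1..T. 2 * (gt t * (w t - u)) + \<bar>c t\<bar> * max 0 (\<bar>u\<bar> - ?B t))"
    using leashed_round_regret[OF B_nonneg gt] by (intro sum_mono) (simp add: wt)
  also have "\<dots> = 2 * (\<Sum>t=1..T. gt t * (w t - u)) + (\<Sum>t=1..T. \<bar>c t\<bar> * max 0 (\<bar>u\<bar> - ?B t))"
    by (simp add: sum.distrib sum_distrib_left)
  finally have surrogate: "(\<Sum>t=1..T. c t * (wt t - u))
      \<le> 2 * R u (max \<eta> G) (map gt [1..<Suc T]) + (\<Sum>t=1..T. \<bar>c t\<bar> * max 0 (\<bar>u\<bar> - ?B t))"
    using base by linarith

  \<comment> \<open>The left-hand side does not depend on \<open>q\<close>, so the bound passes to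
    the infimum.\<close>
  have "(\<Sum>t=1..T. \<bar>c t\<bar> * max 0 (\<bar>u\<bar> - ?B t)) - G * \<bar>u\<bar> \<le> Q q" if "q \<in> {0..1}" for q
    using sum_outside_leash_le[OF assms(4,5) that, of T c g u]
    by (simp add: c Q_def G_eq)
  then have "(\<Sum>t=1..T. \<bar>c t\<bar> * max 0 (\<bar>u\<bar> - ?B t)) - G * \<bar>u\<bar> \<le> (INF q\<in>{0..1}. Q q)"
    by (intro cINF_greatest) auto
  moreover have "(\<Sum>t=1..T. g t * (wt t - u))
      = (\<Sum>t=1..T. (g t - c t) * (wt t - u)) + (\<Sum>t=1..T. c t * (wt t - u))"
    by (simp add: algebra_simps flip: sum.distrib)
  \<comment> \<open>One \<open>G * \<bar>u\<bar>\<close> comes from the truncation error, the other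
    from the last round with leash below \<open>\<bar>u\<bar>\<close>.\<close>
  ultimately have "(\<Sum>t=1..T. g t * (wt t - u)) \<le> 2 * R u (max \<eta> G) (map gt [1..<Suc T])
      + G * k * M + 2 * G * \<bar>u\<bar> + (INF q\<in>{0..1}. Q q)"
    using error surrogate by (simp add: algebra_simps)
  then show ?thesis
    by (simp only: G_def M_def Q_def)
qed

end
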